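(* Let $\mathcal{O}\subseteq\mathbb{R}^n$ be an open convex set and let $f_k:\mathcal{O}\to\mathbb{R}$, $k=1,\dots,m$, be quasi-difference-convex functions on $\mathcal{O}$. Let $F\triangleq(f_k)_{k=1}^m$, let $\Omega\subseteq\mathbb{R}^m$ be an open convex set containing $F(\mathcal{O})$, and let $g:\Omega\to\mathbb{R}$ be a quasi-difference-convex function on $\Omega$. Then the composite function $g\circ F$ is quasi-difference-convex on $\mathcal{O}$. In particular, if $g$ is a difference of two convex functions on $\Omega$ and $F$ is differentiable, then $g\circ F$ is quasi-difference-convex.
   Context: A function $f:\mathcal{O}\to\mathbb{R}$ on an open convex set $\mathcal{O}\subseteq\mathbb{R}^n$ is Bouligand differentiable if it is locally Lipschitz continuous and the directional derivative $f'(\bar x;v)=\lim_{\tau\downarrow 0}\frac{f(\bar x+\tau v)-f(\bar x)}{\tau}$ exists for all $\bar x\in\mathcal{O}$, $v\in\mathbb{R}^n$. A Bouligand differentiable $f$ is quasi-difference-convex (quasi-dc) at $\bar x\in\mathcal{O}$ if $f'(\bar x;\cdot):\mathbb{R}^n\to\mathbb{R}$ is the difference of two convex functions on $\mathbb{R}^n$; it is quasi-dc on $\mathcal{O}$ if this holds at every point of $\mathcal{O}$. Standing convention: all functions are locally Lipschitz continuous (in particular the differentiable map $F$ in the last sentence of the claim). *)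

theory Defs
  imports "HOL-Analysis.Analysis"
begin

text \<open>
  A function on a set \<open>S\<close> is represented by a total function of which only the values on \<open>S\<close> matter.
  In what follows \<open>S\<close> is always meant to be open and convex; these two properties are not part of
  the definitions and have to be assumed wherever the definitions are used. Since \<open>S\<close> is open,
  directional derivatives at points of \<open>S\<close> do not depend on the values outside \<open>S\<close>.
\<close>

definition locally_lipschitz_on ::
    "'a::metric_space set \<Rightarrow> ('a \<Rightarrow> 'b::metric_space) \<Rightarrow> bool" where
  "locally_lipschitz_on S f \<longleftrightarrow>
     (\<forall>x\<in>S. \<exists>\<epsilon>>0. \<exists>L. L-lipschitz_on (ball x \<epsilon> \<inter> S) f)"

definition dir_quotient ::
    "('a::real_normed_vector \<Rightarrow> real) \<Rightarrow> 'a \<Rightarrow> 'a \<Rightarrow> real \<Rightarrow> real" where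
  "dir_quotient f x v \<tau> = (f (x + \<tau> *\<^sub>R v) - f x) / \<tau>"

definition dir_differentiable ::
    "('a::real_normed_vector \<Rightarrow> real) \<Rightarrow> 'a \<Rightarrow> 'a \<Rightarrow> bool" where
  "dir_differentiable f x v \<longleftrightarrow> (\<exists>l. (dir_quotient f x v \<longlongrightarrow> l) (at_right 0))"

text \<open>Only meaningful if \<open>dir_differentiable f x v\<close> holds.\<close>

definition dir_deriv ::
    "('a::real_normed_vector \<Rightarrow> real) \<Rightarrow> 'a \<Rightarrow> 'a \<Rightarrow> real" where
  "dir_deriv f x v = Lim (at_right 0) (dir_quotient f x v)"

definition bouligand_differentiable_on ::
    "'a::real_normed_vector set \<Rightarrow> ('a \<Rightarrow> real) \<Rightarrow> bool" where
  "bouligand_differentiable_on S f \<longleftrightarrow>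
     locally_lipschitz_on S f \<and> (\<forall>x\<in>S. \<forall>v. dir_differentiable f x v)"

definition dc_on :: "'a::real_vector set \<Rightarrow> ('a \<Rightarrow> real) \<Rightarrow> bool" where
  "dc_on S h \<longleftrightarrow>
     (\<exists>p q. convex_on S p \<and> convex_on S q \<and> (\<forall>x\<in>S. h x = p x - q x))"

definition quasi_dc_at ::
    "'a::real_normed_vector set \<Rightarrow> ('a \<Rightarrow> real) \<Rightarrow> 'a \<Rightarrow> bool" where
  "quasi_dc_at S f x \<longleftrightarrow>
     x \<in> S \<and> bouligand_differentiable_on S f \<and> dc_on UNIV (dir_deriv f x)"

definition quasi_dc_on ::
    "'a::real_normed_vector set \<Rightarrow> ('a \<Rightarrow> real) \<Rightarrow> bool" where
  "quasi_dc_on S f \<longleftrightarrow> (\<forall>x\<in>S. quasi_dc_at S f x)"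

end

theory Submission
  imports Defs
begin

text \<open>
  Local Lipschitz continuity of \<open>g\<close> gives the chain rule
  \<open>(g \<circ> F)'(x; v) = g'(F x; F'(x; v))\<close>
  (\<open>dir_quotient_compose_tendsto\<close>), so the point is that \<open>g'(F x; \<cdot>) \<circ> F'(x; \<cdot>)\<close> is a
  difference of convex functions on the whole space. Composing two global differences of convex
  functions is delicate when the outer convex parts are not globally Lipschitz, but here the outer
  function \<open>h = g'(F x; \<cdot>)\<close> is positively homogeneous. If \<open>h = p - q\<close> with convex
  \<open>p\<close>, \<open>q\<close>, then taking directional derivatives at the origin gives
  \<open>h = h'(0; \<cdot>) = p'(0; \<cdot>) - q'(0; \<cdot>)\<close>, a difference of sublinear functions
  (\<open>homogeneous_dc_imp_sublinear_diff\<close>).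

  A sublinear function \<open>P\<close> on a finite-dimensional space satisfies \<open>P w \<le> C \<parallel>w\<parallel>\<close>. If the
  components of \<open>G\<close> are \<open>a\<^sub>k - b\<^sub>k\<close> with convex \<open>a\<^sub>k\<close>, \<open>b\<^sub>k\<close>, then the amount by which
  \<open>P \<circ> G\<close> violates convexity is at most \<open>C\<close> times the sum of the convexity gaps of the
  \<open>a\<^sub>k\<close> and \<open>b\<^sub>k\<close>. Hence \<open>P \<circ> G + C \<Sum>\<^sub>k (a\<^sub>k + b\<^sub>k)\<close> is convex, and \<open>P \<circ> G\<close> is
  a difference of convex functions (\<open>dc_on_sublinear_compose\<close>).

  The second claim is an instance of the first. A convex function on an open set of a Euclidean
  space is locally Lipschitz with convex directional derivatives, so a difference of convex
  functions is quasi-dc (\<open>dc_on_imp_quasi_dc_on\<close>); a differentiable function has linear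
  directional derivatives, so it is quasi-dc when it is locally Lipschitz
  (\<open>differentiable_imp_quasi_dc_on\<close>).
\<close>

section \<open>One-sided directional derivatives\<close>

lemma dir_deriv_eqI:
  assumes "(dir_quotient f x v \<longlongrightarrow> l) (at_right 0)"
  shows "dir_deriv f x v = l"
  unfolding dir_deriv_def using assms by (rule tendsto_Lim[rotated]) simp

lemma dir_differentiable_tendsto:
  assumes "dir_differentiable f x v"
  shows "(dir_quotient f x v \<longlongrightarrow> dir_deriv f x v) (at_right 0)"
  using assms dir_deriv_eqI unfolding dir_differentiable_def by blast

lemma eventually_along_ray:
  fixes x v :: "'a::real_normed_vector"
  assumes "open S" "x \<in> S"
  shows "\<forall>\<^sub>F \<tau> in at_right 0. x + \<tau> *\<^sub>R v \<in> S"
proof -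
  have "((\<lambda>\<tau>. x + \<tau> *\<^sub>R v) \<longlongrightarrow> x + 0 *\<^sub>R v) (at_right 0)"
    by (intro tendsto_intros)
  then show ?thesis
    using assms by (auto dest: topological_tendstoD)
qed

lemma dir_deriv_scaleR:
  assumes d: "dir_differentiable f x v" and "c \<ge> 0"
  shows "dir_deriv f x (c *\<^sub>R v) = c * dir_deriv f x v"
proof (cases "c = 0")
  case True
  have "dir_quotient f x (0 *\<^sub>R v) = (\<lambda>_. 0)"
    by (auto simp: dir_quotient_def)
  then show ?thesis
    using True dir_deriv_eqI[of f x "0 *\<^sub>R v" 0] by simp
next
  case False
  with \<open>c \<ge> 0\<close> have "c > 0" by simp
  have "filterlim (\<lambda>\<tau>. c * \<tau>) (at_right 0) (at_right 0)"
    unfolding filterlim_at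
  proof
    show "((\<lambda>\<tau>. c * \<tau>) \<longlongrightarrow> 0) (at_right 0)"
      by (rule tendsto_eq_intros | simp)+
    show "\<forall>\<^sub>F \<tau> in at_right 0. c * \<tau> \<in> {0<..} \<and> c * \<tau> \<noteq> 0"
      using \<open>c > 0\<close> by (auto simp: eventually_at_filter)
  qed
  from filterlim_compose[OF dir_differentiable_tendsto[OF d] this]
  have "((\<lambda>\<tau>. c * dir_quotient f x v (c * \<tau>)) \<longlongrightarrow> c * dir_deriv f x v) (at_right 0)"
    by (intro tendsto_intros)
  moreover have "(\<lambda>\<tau>. c * dir_quotient f x v (c * \<tau>)) = dir_quotient f x (c *\<^sub>R v)"
    using \<open>c > 0\<close> by (auto simp: dir_quotient_def fun_eq_iff mult.commute)
  ultimately show ?thesis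
    using dir_deriv_eqI by metis
qed

lemma dir_quotient_diff_tendsto:
  assumes "open S" "x \<in> S" and eq: "\<And>y. y \<in> S \<Longrightarrow> h y = p y - q y"
    and p: "(dir_quotient p x v \<longlongrightarrow> a) (at_right 0)"
    and q: "(dir_quotient q x v \<longlongrightarrow> b) (at_right 0)"
  shows "(dir_quotient h x v \<longlongrightarrow> a - b) (at_right 0)"
proof (rule Lim_transform_eventually[OF tendsto_diff[OF p q]])
  show "\<forall>\<^sub>F \<tau> in at_right 0. dir_quotient p x v \<tau> - dir_quotient q x v \<tau> = dir_quotient h x v \<tau>"
    using eventually_along_ray[OF assms(1,2), of v]
  proof eventually_elim
    case (elim \<tau>)
    then show ?case
      using \<open>x \<in> S\<close> by (simp add: dir_quotient_def eq diff_divide_distrib)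
  qed
qed

lemma dir_quotient_has_derivative:
  assumes "(f has_derivative D) (at x)"
  shows "(dir_quotient f x v \<longlongrightarrow> D v) (at_right 0)"
proof -
  interpret D: bounded_linear D
    using assms by (rule has_derivative_bounded_linear)
  have "((\<lambda>\<tau>. x + \<tau> *\<^sub>R v) has_derivative (\<lambda>\<tau>. \<tau> *\<^sub>R v)) (at 0 within {0<..})"
    by (auto intro!: derivative_eq_intros)
  moreover have "(f has_derivative D) (at (x + 0 *\<^sub>R v))"
    using assms by simp
  ultimately have "((\<lambda>\<tau>. f (x + \<tau> *\<^sub>R v)) has_derivative (\<lambda>\<tau>. D (\<tau> *\<^sub>R v))) (at 0 within {0<..})"
    by (rule has_derivative_compose)
  then have "((\<lambda>\<tau>. f (x + \<tau> *\<^sub>R v)) has_field_derivative D v) (at 0 within {0<..})"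
    by (simp add: has_field_derivative_def D.scaleR mult_commute_abs)
  then show ?thesis
    by (simp add: has_field_derivative_iff dir_quotient_def[abs_def])
qed

text \<open>
  The curves \<open>F (x + \<tau> v)\<close> and \<open>F x + \<tau> w\<close> differ by \<open>o(\<tau>)\<close>, and a Lipschitz outer function keeps
  that order, so it may be evaluated along the straight ray instead. Mere existence of the
  directional derivatives of \<open>g\<close> would not justify this replacement.
\<close>

lemma dir_quotient_compose_tendsto:
  fixes F :: "'a::real_normed_vector \<Rightarrow> 'b::real_normed_vector"
  assumes lip: "locally_lipschitz_on \<Omega> g" and "open \<Omega>" "F x \<in> \<Omega>"
    and F: "((\<lambda>\<tau>. (F (x + \<tau> *\<^sub>R v) - F x) /\<^sub>R \<tau>) \<longlongrightarrow> w) (at_right 0)"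
    and g: "(dir_quotient g (F x) w \<longlongrightarrow> l) (at_right 0)"
  shows "(dir_quotient (g \<circ> F) x v \<longlongrightarrow> l) (at_right 0)"
proof -
  define Q where "Q \<tau> = (F (x + \<tau> *\<^sub>R v) - F x) /\<^sub>R \<tau>" for \<tau>
  have Q: "(Q \<longlongrightarrow> w) (at_right 0)"
    using F unfolding Q_def .
  obtain \<epsilon> L where "\<epsilon> > 0" and L: "L-lipschitz_on (ball (F x) \<epsilon> \<inter> \<Omega>) g"
    using lip \<open>F x \<in> \<Omega>\<close> unfolding locally_lipschitz_on_def by blast
  let ?U = "ball (F x) \<epsilon> \<inter> \<Omega>"
  have U: "open ?U" "F x \<in> ?U"
    using \<open>\<epsilon> > 0\<close> \<open>open \<Omega>\<close> \<open>F x \<in> \<Omega>\<close> by auto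
  have "((\<lambda>\<tau>. F x + \<tau> *\<^sub>R Q \<tau>) \<longlongrightarrow> F x + 0 *\<^sub>R w) (at_right 0)"
    by (intro tendsto_intros Q)
  then have inU: "\<forall>\<^sub>F \<tau> in at_right 0. F x + \<tau> *\<^sub>R Q \<tau> \<in> ?U"
    using U by (auto dest: topological_tendstoD simp del: Int_iff)
  have "((\<lambda>\<tau>. dir_quotient (g \<circ> F) x v \<tau> - dir_quotient g (F x) w \<tau>) \<longlongrightarrow> 0) (at_right 0)"
  proof (rule Lim_null_comparison)
    have "((\<lambda>\<tau>. L * norm (Q \<tau> - w)) \<longlongrightarrow> L * norm (w - w)) (at_right 0)"
      by (intro tendsto_intros Q)
    then show "((\<lambda>\<tau>. L * norm (Q \<tau> - w)) \<longlongrightarrow> 0) (at_right 0)"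
      by simp
    show "\<forall>\<^sub>F \<tau> in at_right 0.
      norm (dir_quotient (g \<circ> F) x v \<tau> - dir_quotient g (F x) w \<tau>) \<le> L * norm (Q \<tau> - w)"
      using inU eventually_along_ray[OF U, of w] eventually_at_right_less
    proof eventually_elim
      case (elim \<tau>)
      have eq: "F (x + \<tau> *\<^sub>R v) = F x + \<tau> *\<^sub>R Q \<tau>"
        using elim(3) by (simp add: Q_def)
      have "\<bar>g (F x + \<tau> *\<^sub>R Q \<tau>) - g (F x + \<tau> *\<^sub>R w)\<bar>
          \<le> L * norm ((F x + \<tau> *\<^sub>R Q \<tau>) - (F x + \<tau> *\<^sub>R w))"
        using lipschitz_onD[OF L elim(1,2)] by (simp add: dist_norm)
      also have "(F x + \<tau> *\<^sub>R Q \<tau>) - (F x + \<tau> *\<^sub>R w) = \<tau> *\<^sub>R (Q \<tau> - w)"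
        by (simp add: algebra_simps)
      finally have "\<bar>g (F x + \<tau> *\<^sub>R Q \<tau>) - g (F x + \<tau> *\<^sub>R w)\<bar> \<le> \<tau> * (L * norm (Q \<tau> - w))"
        using elim(3) by (simp add: mult_ac)
      moreover have "dir_quotient (g \<circ> F) x v \<tau> - dir_quotient g (F x) w \<tau>
          = (g (F x + \<tau> *\<^sub>R Q \<tau>) - g (F x + \<tau> *\<^sub>R w)) / \<tau>"
        by (simp add: dir_quotient_def eq diff_divide_distrib)
      ultimately show ?case
        using elim(3) by (simp add: divide_le_eq mult.commute)
    qed
  qed
  from tendsto_add[OF this g] show ?thesis by simp
qed


section \<open>Local Lipschitz continuity\<close>

lemma locally_lipschitz_on_imp_continuous_on:
  assumes "locally_lipschitz_on S f" "open S"
  shows "continuous_on S f"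
proof (rule continuous_at_imp_continuous_on, rule ballI)
  fix x assume "x \<in> S"
  then obtain \<epsilon> L where "\<epsilon> > 0" and L: "L-lipschitz_on (ball x \<epsilon> \<inter> S) f"
    using assms unfolding locally_lipschitz_on_def by blast
  then have "continuous_on (ball x \<epsilon> \<inter> S) f"
    by (intro lipschitz_on_continuous_on)
  then show "isCont f x"
    using \<open>\<epsilon> > 0\<close> \<open>x \<in> S\<close> \<open>open S\<close> by (simp add: continuous_on_eq_continuous_at open_Int)
qed

lemma locally_lipschitz_on_compose:
  assumes F: "locally_lipschitz_on S F" and g: "locally_lipschitz_on T g"
    and "F ` S \<subseteq> T" "open S"
  shows "locally_lipschitz_on S (g \<circ> F)"
  unfolding locally_lipschitz_on_def
proof
  fix x assume "x \<in> S"
  then obtain \<epsilon> L where e: "\<epsilon> > 0" and L: "L-lipschitz_on (ball x \<epsilon> \<inter> S) F"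
    using F unfolding locally_lipschitz_on_def by blast
  obtain \<delta> M where d: "\<delta> > 0" and M: "M-lipschitz_on (ball (F x) \<delta> \<inter> T) g"
    using g \<open>x \<in> S\<close> \<open>F ` S \<subseteq> T\<close> unfolding locally_lipschitz_on_def by blast
  have "isCont F x"
    using locally_lipschitz_on_imp_continuous_on[OF F \<open>open S\<close>] \<open>x \<in> S\<close> \<open>open S\<close>
    by (simp add: continuous_on_eq_continuous_at)
  then obtain r where r: "r > 0" "F ` ball x r \<subseteq> ball (F x) \<delta>"
    using d unfolding continuous_at_ball by blast
  let ?B = "ball x (min \<epsilon> r) \<inter> S"
  have "L-lipschitz_on ?B F"
    using L by (rule lipschitz_on_subset) auto
  moreover have "M-lipschitz_on (F ` ?B) g"
    using M by (rule lipschitz_on_subset) (use r \<open>F ` S \<subseteq> T\<close> in auto)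
  ultimately have "(M * L)-lipschitz_on ?B (g \<circ> F)"
    by (rule lipschitz_on_compose)
  then show "\<exists>\<epsilon>>0. \<exists>L. L-lipschitz_on (ball x \<epsilon> \<inter> S) (g \<circ> F)"
    using e r(1) by (intro exI[of _ "min \<epsilon> r"]) auto
qed

lemma locally_lipschitz_on_vec_iff:
  fixes F :: "'a::metric_space \<Rightarrow> real ^ 'm"
  shows "locally_lipschitz_on S F \<longleftrightarrow> (\<forall>k. locally_lipschitz_on S (\<lambda>x. F x $ k))"
proof (intro iffI allI)
  fix k :: 'm
  assume F: "locally_lipschitz_on S F"
  have "L-lipschitz_on A (\<lambda>x. F x $ k)" if "L-lipschitz_on A F" for L A
    using that order_trans[OF dist_vec_nth_le] unfolding lipschitz_on_def by blast
  then show "locally_lipschitz_on S (\<lambda>x. F x $ k)"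
    using F unfolding locally_lipschitz_on_def by blast
next
  assume comp: "\<forall>k. locally_lipschitz_on S (\<lambda>x. F x $ k)"
  show "locally_lipschitz_on S F"
    unfolding locally_lipschitz_on_def
  proof
    fix x assume "x \<in> S"
    with comp have "\<forall>k. \<exists>\<epsilon> L. \<epsilon> > 0 \<and> L-lipschitz_on (ball x \<epsilon> \<inter> S) (\<lambda>x. F x $ k)"
      unfolding locally_lipschitz_on_def by blast
    then obtain \<epsilon> L :: "'m \<Rightarrow> real" where e: "\<And>k. \<epsilon> k > 0"
      and L: "\<And>k. (L k)-lipschitz_on (ball x (\<epsilon> k) \<inter> S) (\<lambda>x. F x $ k)"
      by metis
    define r where "r = Min (range \<epsilon>)"
    have r: "r > 0" "\<And>k. r \<le> \<epsilon> k"
      using e by (auto simp: r_def)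
    have "(\<Sum>k\<in>UNIV. L k)-lipschitz_on (ball x r \<inter> S) F"
    proof (rule lipschitz_onI)
      show "0 \<le> (\<Sum>k\<in>UNIV. L k)"
        using L lipschitz_on_nonneg by (intro sum_nonneg) blast
      fix y z assume yz: "y \<in> ball x r \<inter> S" "z \<in> ball x r \<inter> S"
      have "dist (F y) (F z) \<le> (\<Sum>k\<in>UNIV. \<bar>(F y - F z) $ k\<bar>)"
        unfolding dist_norm by (rule norm_le_l1_cart)
      also have "\<dots> \<le> (\<Sum>k\<in>UNIV. L k * dist y z)"
      proof (rule sum_mono)
        fix k
        have "dist (F y $ k) (F z $ k) \<le> L k * dist y z"
          using yz r(2)[of k] by (intro lipschitz_onD[OF L]) auto
        then show "\<bar>(F y - F z) $ k\<bar> \<le> L k * dist y z"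
          by (simp add: dist_real_def)
      qed
      finally show "dist (F y) (F z) \<le> (\<Sum>k\<in>UNIV. L k) * dist y z"
        by (simp add: sum_distrib_right)
    qed
    then show "\<exists>\<epsilon>>0. \<exists>L. L-lipschitz_on (ball x \<epsilon> \<inter> S) F"
      using r(1) by blast
  qed
qed

lemma locally_lipschitz_on_diff:
  fixes p q :: "'a::metric_space \<Rightarrow> real"
  assumes p: "locally_lipschitz_on S p" and q: "locally_lipschitz_on S q"
    and eq: "\<And>x. x \<in> S \<Longrightarrow> h x = p x - q x"
  shows "locally_lipschitz_on S h"
  unfolding locally_lipschitz_on_def
proof
  fix x assume "x \<in> S"
  obtain \<epsilon> L where e: "\<epsilon> > 0" and L: "L-lipschitz_on (ball x \<epsilon> \<inter> S) p"
    using p \<open>x \<in> S\<close> unfolding locally_lipschitz_on_def by blast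
  obtain \<delta> M where d: "\<delta> > 0" and M: "M-lipschitz_on (ball x \<delta> \<inter> S) q"
    using q \<open>x \<in> S\<close> unfolding locally_lipschitz_on_def by blast
  have "(L + M)-lipschitz_on (ball x (min \<epsilon> \<delta>) \<inter> S) (\<lambda>y. p y - q y)"
    by (intro lipschitz_on_diff lipschitz_on_subset[OF L] lipschitz_on_subset[OF M]) auto
  then have "(L + M)-lipschitz_on (ball x (min \<epsilon> \<delta>) \<inter> S) h"
    by (rule lipschitz_on_transform) (auto simp: eq)
  then show "\<exists>\<epsilon>>0. \<exists>L. L-lipschitz_on (ball x \<epsilon> \<inter> S) h"
    using e d by (intro exI[of _ "min \<epsilon> \<delta>"]) auto
qed


section \<open>Convex functions on open sets\<close>

text \<open>
  A convex function is bounded by some \<open>M\<close> on a compact ball inside \<open>S\<close>. A steep ascent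
  between two points of the concentric ball of half the radius would, by convexity, continue at
  least as steeply beyond the second point and exceed \<open>M\<close> before leaving the larger ball.
\<close>

lemma convex_on_imp_locally_lipschitz_on:
  fixes f :: "'a::euclidean_space \<Rightarrow> real"
  assumes cvx: "convex_on S f" and "open S"
  shows "locally_lipschitz_on S f"
  unfolding locally_lipschitz_on_def
proof
  fix x assume "x \<in> S"
  then obtain r where r: "r > 0" "cball x r \<subseteq> S"
    using \<open>open S\<close> open_contains_cball by blast
  define \<epsilon> where "\<epsilon> = r / 2"
  have e: "\<epsilon> > 0" "r = 2 * \<epsilon>"
    using r by (simp_all add: \<epsilon>_def)
  have "continuous_on (cball x r) f"
    using convex_on_continuous[OF \<open>open S\<close> cvx] r(2) continuous_on_subset by blast
  then have "bounded (f ` cball x r)"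
    by (intro compact_imp_bounded compact_continuous_image) auto
  then obtain M where M: "M > 0" "\<And>y. y \<in> cball x r \<Longrightarrow> \<bar>f y\<bar> \<le> M"
    unfolding bounded_pos by auto
  have one_sided: "f v - f u \<le> 2 * M / \<epsilon> * dist u v"
    if u: "u \<in> ball x \<epsilon>" and v: "v \<in> ball x \<epsilon>" for u v
  proof (cases "u = v")
    case False
    define \<delta> where "\<delta> = dist u v"
    have d: "\<delta> > 0"
      using False by (simp add: \<delta>_def)
    \<comment> \<open>Prolong the segment from \<open>u\<close> to \<open>v\<close> by the length \<open>\<epsilon>\<close>: the endpoint \<open>z\<close> stays in
      \<open>cball x (2 * \<epsilon>)\<close>, and \<open>v\<close> is a convex combination of \<open>u\<close> and \<open>z\<close>.\<close>
    define z where "z = v + (\<epsilon> / \<delta>) *\<^sub>R (v - u)"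
    have "dist z v = \<epsilon>"
      using d e by (simp add: z_def dist_norm \<delta>_def norm_minus_commute)
    then have z: "z \<in> cball x r"
      using v e dist_triangle[of x z v] by (auto simp: dist_commute)
    have uc: "u \<in> cball x r"
      using u e by auto
    define t where "t = \<delta> / (\<delta> + \<epsilon>)"
    have t: "0 \<le> t" "t \<le> 1" "t \<le> \<delta> / \<epsilon>"
      using d e by (auto simp: t_def field_simps)
    have "t * (\<epsilon> / \<delta>) = 1 - t"
      using d e by (simp add: t_def field_simps)
    then have "(1 - t) *\<^sub>R u + t *\<^sub>R z = v"
      by (simp add: z_def algebra_simps flip: scaleR_add_left)
    then have "f v \<le> (1 - t) * f u + t * f z"
      using convex_onD[OF cvx t(1,2), of u z] uc z r(2) by (metis subsetD)
    then have "f v - f u \<le> t * (f z - f u)"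
      by (simp add: algebra_simps)
    also have "\<dots> \<le> t * (2 * M)"
      using M(2)[OF z] M(2)[OF uc] t(1) by (intro mult_left_mono) auto
    also have "\<dots> \<le> \<delta> / \<epsilon> * (2 * M)"
      using t(3) M(1) by (intro mult_right_mono) auto
    finally show ?thesis
      by (simp add: \<delta>_def mult_ac)
  qed simp
  have "(2 * M / \<epsilon>)-lipschitz_on (ball x \<epsilon> \<inter> S) f"
  proof (rule lipschitz_onI)
    fix u v assume "u \<in> ball x \<epsilon> \<inter> S" "v \<in> ball x \<epsilon> \<inter> S"
    then show "dist (f u) (f v) \<le> 2 * M / \<epsilon> * dist u v"
      using one_sided[of u v] one_sided[of v u] by (auto simp: dist_real_def dist_commute abs_le_iff)
  qed (use M e in auto)
  then show "\<exists>\<epsilon>>0. \<exists>L. L-lipschitz_on (ball x \<epsilon> \<inter> S) f"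
    using e by blast
qed

text \<open>
  Difference quotients of a convex function are nondecreasing in the step size, and local Lipschitz
  continuity bounds them from below, so they converge to their infimum.
\<close>

lemma convex_on_imp_dir_differentiable:
  fixes f :: "'a::euclidean_space \<Rightarrow> real"
  assumes cvx: "convex_on S f" and "open S" "x \<in> S"
  shows "dir_differentiable f x v"
proof -
  obtain \<epsilon> L where "\<epsilon> > 0" and L: "L-lipschitz_on (ball x \<epsilon> \<inter> S) f"
    using convex_on_imp_locally_lipschitz_on[OF cvx \<open>open S\<close>] \<open>x \<in> S\<close>
    unfolding locally_lipschitz_on_def by blast
  have "\<forall>\<^sub>F \<tau> in at_right 0. x + \<tau> *\<^sub>R v \<in> ball x \<epsilon> \<inter> S"
    using \<open>\<epsilon> > 0\<close> assms by (intro eventually_along_ray) auto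
  then obtain b where "b > 0" and b: "\<And>\<tau>. 0 < \<tau> \<Longrightarrow> \<tau> < b \<Longrightarrow> x + \<tau> *\<^sub>R v \<in> ball x \<epsilon> \<inter> S"
    unfolding eventually_at_right_field by auto
  let ?d = "dir_quotient f x v"
  have mono: "?d s \<le> ?d t" if "0 < s" "s \<le> t" "t < b" for s t
  proof -
    have "(1 - s / t) *\<^sub>R x + (s / t) *\<^sub>R (x + t *\<^sub>R v) = x + s *\<^sub>R v"
      using that by (simp add: algebra_simps)
    then have "f (x + s *\<^sub>R v) \<le> (1 - s / t) * f x + (s / t) * f (x + t *\<^sub>R v)"
      using convex_onD[OF cvx, of "s / t" x "x + t *\<^sub>R v"] that b[of t] \<open>x \<in> S\<close> by auto
    then show ?thesis
      using that by (simp add: dir_quotient_def field_simps)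
  qed
  have "bdd_below (?d ` {0<..<b})"
  proof (rule bdd_belowI2)
    fix \<tau> assume "\<tau> \<in> {0<..<b}"
    then have "dist (f (x + \<tau> *\<^sub>R v)) (f x) \<le> L * dist (x + \<tau> *\<^sub>R v) x"
      using b \<open>\<epsilon> > 0\<close> \<open>x \<in> S\<close> by (intro lipschitz_onD[OF L]) auto
    then show "- (L * norm v) \<le> ?d \<tau>"
      using \<open>\<tau> \<in> {0<..<b}\<close> by (simp add: dir_quotient_def dist_norm abs_le_iff field_simps)
  qed
  note Inf_lower = cINF_lower[OF this]
  let ?l = "Inf (?d ` {0<..<b})"
  have "(?d \<longlongrightarrow> ?l) (at_right 0)"
  proof (rule order_tendstoI)
    fix a assume "a < ?l"
    moreover have "\<forall>\<^sub>F \<tau> in at_right 0. \<tau> \<in> {0<..<b}"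
      using \<open>b > 0\<close> by (rule eventually_at_right_real)
    ultimately show "\<forall>\<^sub>F \<tau> in at_right 0. a < ?d \<tau>"
      using Inf_lower by (auto elim!: eventually_mono intro: less_le_trans)
  next
    fix a assume "?l < a"
    then obtain t where t: "0 < t" "t < b" "?d t < a"
      using cInf_lessD[of "?d ` {0<..<b}" a] \<open>b > 0\<close> by auto
    have "\<forall>\<^sub>F \<tau> in at_right 0. \<tau> \<in> {0<..<t}"
      using t(1) by (rule eventually_at_right_real)
    then show "\<forall>\<^sub>F \<tau> in at_right 0. ?d \<tau> < a"
    proof eventually_elim
      case (elim \<tau>)
      then show ?case
        using mono[of \<tau> t] t by auto
    qed
  qed
  then show ?thesis
    unfolding dir_differentiable_def by blast
qed

text \<open>
  For small \<open>\<tau>\<close> the convexity inequality holds for the difference quotients with step \<open>\<tau>\<close>, as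
  functions of the direction, and it survives the limit \<open>\<tau> \<longrightarrow> 0\<close>.
\<close>

lemma convex_on_dir_deriv:
  fixes f :: "'a::euclidean_space \<Rightarrow> real"
  assumes cvx: "convex_on S f" and "open S" "x \<in> S"
  shows "convex_on UNIV (dir_deriv f x)"
proof (rule convex_onI)
  fix t :: real and u v :: 'a
  assume t: "0 < t" "t < 1"
  let ?w = "(1 - t) *\<^sub>R u + t *\<^sub>R v"
  note lim = dir_differentiable_tendsto[OF convex_on_imp_dir_differentiable[OF assms]]
  show "dir_deriv f x ?w \<le> (1 - t) * dir_deriv f x u + t * dir_deriv f x v"
  proof (rule tendsto_le[OF _ _ lim])
    show "((\<lambda>\<tau>. (1 - t) * dir_quotient f x u \<tau> + t * dir_quotient f x v \<tau>)
        \<longlongrightarrow> (1 - t) * dir_deriv f x u + t * dir_deriv f x v) (at_right 0)"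
      by (intro tendsto_intros lim)
    show "\<forall>\<^sub>F \<tau> in at_right 0.
        dir_quotient f x ?w \<tau> \<le> (1 - t) * dir_quotient f x u \<tau> + t * dir_quotient f x v \<tau>"
      using eventually_along_ray[OF assms(2,3), of u] eventually_along_ray[OF assms(2,3), of v]
        eventually_at_right_less
    proof eventually_elim
      case (elim \<tau>)
      have "(1 - t) *\<^sub>R (x + \<tau> *\<^sub>R u) + t *\<^sub>R (x + \<tau> *\<^sub>R v) = x + \<tau> *\<^sub>R ?w"
        by (simp add: algebra_simps)
      then have "f (x + \<tau> *\<^sub>R ?w) \<le> (1 - t) * f (x + \<tau> *\<^sub>R u) + t * f (x + \<tau> *\<^sub>R v)"
        using convex_onD[OF cvx, of t "x + \<tau> *\<^sub>R u" "x + \<tau> *\<^sub>R v"] t elim by auto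
      then have "f (x + \<tau> *\<^sub>R ?w) - f x
          \<le> (1 - t) * (f (x + \<tau> *\<^sub>R u) - f x) + t * (f (x + \<tau> *\<^sub>R v) - f x)"
        by argo
      from divide_right_mono[OF this, of \<tau>] show ?case
        using elim(3) by (simp add: dir_quotient_def add_divide_distrib)
    qed
  qed simp
qed simp

lemma dc_on_imp_quasi_dc_on:
  fixes g :: "'a::euclidean_space \<Rightarrow> real"
  assumes "dc_on S g" "open S"
  shows "quasi_dc_on S g"
proof -
  obtain p q where p: "convex_on S p" and q: "convex_on S q" and eq: "\<And>x. x \<in> S \<Longrightarrow> g x = p x - q x"
    using assms unfolding dc_on_def by blast
  have lip: "locally_lipschitz_on S g"
    using convex_on_imp_locally_lipschitz_on[OF p \<open>open S\<close>]
      convex_on_imp_locally_lipschitz_on[OF q \<open>open S\<close>] eq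
    by (rule locally_lipschitz_on_diff)
  have lim: "(dir_quotient g x v \<longlongrightarrow> dir_deriv p x v - dir_deriv q x v) (at_right 0)"
    if "x \<in> S" for x v
    using \<open>open S\<close> that eq
    by (rule dir_quotient_diff_tendsto)
      (auto intro: dir_differentiable_tendsto convex_on_imp_dir_differentiable p q \<open>open S\<close> that)
  have "dc_on UNIV (dir_deriv g x)" if "x \<in> S" for x
    unfolding dc_on_def
    using convex_on_dir_deriv[OF p \<open>open S\<close> that] convex_on_dir_deriv[OF q \<open>open S\<close> that]
      dir_deriv_eqI[OF lim[OF that]] by blast
  then show ?thesis
    using lip lim
    unfolding quasi_dc_on_def quasi_dc_at_def bouligand_differentiable_on_def dir_differentiable_def
    by blast
qed


section \<open>Sublinear functions\<close>

definition sublinear :: "('a::real_vector \<Rightarrow> real) \<Rightarrow> bool" where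
  "sublinear P \<longleftrightarrow> convex_on UNIV P \<and> (\<forall>c\<ge>0. \<forall>v. P (c *\<^sub>R v) = c * P v)"

lemma sublinear_add_le:
  assumes "sublinear P"
  shows "P (u + v) \<le> P u + P v"
proof -
  have hom: "P (2 *\<^sub>R w) = 2 * P w" for w
    using assms by (simp add: sublinear_def)
  have "P ((1/2) *\<^sub>R (2 *\<^sub>R u) + (1/2) *\<^sub>R (2 *\<^sub>R v)) \<le> (1/2) * P (2 *\<^sub>R u) + (1/2) * P (2 *\<^sub>R v)"
    using assms convex_onD[of UNIV P "1/2" "2 *\<^sub>R u" "2 *\<^sub>R v"] by (simp add: sublinear_def)
  then show ?thesis
    by (simp add: hom)
qed

text \<open>
  The Lipschitz estimate at the origin holds on a small ball only; homogeneity carries it to the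
  whole space.
\<close>

lemma sublinear_le_norm:
  fixes P :: "'a::euclidean_space \<Rightarrow> real"
  assumes "sublinear P"
  obtains C where "C \<ge> 0" "\<And>v. P v \<le> C * norm v"
proof -
  have hom: "P (c *\<^sub>R v) = c * P v" if "c \<ge> 0" for c v
    using assms that by (simp add: sublinear_def)
  have P0: "P 0 = 0"
    using hom[of 0 0] by simp
  obtain \<epsilon> L where "\<epsilon> > 0" and L: "L-lipschitz_on (ball 0 \<epsilon> \<inter> UNIV) P"
    using assms convex_on_imp_locally_lipschitz_on[of UNIV P]
    unfolding sublinear_def locally_lipschitz_on_def by blast
  have "P v \<le> L * norm v" for v
  proof (cases "v = 0")
    case False
    define c where "c = \<epsilon> / (2 * norm v)"
    have c: "c > 0" "c * norm v < \<epsilon>"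
      using False \<open>\<epsilon> > 0\<close> by (auto simp: c_def)
    have "dist (P (c *\<^sub>R v)) (P 0) \<le> L * dist (c *\<^sub>R v) 0"
      using c \<open>\<epsilon> > 0\<close> by (intro lipschitz_onD[OF L]) auto
    then have "c * P v \<le> c * (L * norm v)"
      using c by (simp add: hom P0 dist_real_def abs_le_iff mult_ac)
    then show ?thesis
      using c by simp
  qed (simp add: P0)
  with lipschitz_on_nonneg[OF L] show thesis
    using that by blast
qed

text \<open>
  A positively homogeneous function is its own directional derivative at the origin. Differentiating
  an arbitrary convex decomposition there replaces both parts by sublinear ones. The gain is that
  sublinear functions have linear growth, which arbitrary convex parts need not have.
\<close>

lemma homogeneous_dc_imp_sublinear_diff:
  fixes h :: "'a::euclidean_space \<Rightarrow> real"
  assumes "dc_on UNIV h" and hom: "\<And>c v. c \<ge> 0 \<Longrightarrow> h (c *\<^sub>R v) = c * h v"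
  obtains P Q where "sublinear P" "sublinear Q" "\<And>v. h v = P v - Q v"
proof -
  obtain p q where p: "convex_on UNIV p" and q: "convex_on UNIV q" and eq: "\<And>v. h v = p v - q v"
    using assms unfolding dc_on_def by blast
  note dd = convex_on_imp_dir_differentiable[OF _ open_UNIV UNIV_I]
  have sub: "sublinear (dir_deriv f 0)" if "convex_on UNIV f" for f :: "'a \<Rightarrow> real"
    using convex_on_dir_deriv[OF that] dir_deriv_scaleR[OF dd[OF that]]
    by (simp add: sublinear_def)
  have "h v = dir_deriv p 0 v - dir_deriv q 0 v" for v
  proof -
    have "(dir_quotient h 0 v \<longlongrightarrow> dir_deriv p 0 v - dir_deriv q 0 v) (at_right 0)"
      by (rule dir_quotient_diff_tendsto[of UNIV])
        (auto simp: eq intro: dir_differentiable_tendsto dd p q)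
    moreover have "(dir_quotient h 0 v \<longlongrightarrow> h v) (at_right 0)"
    proof (rule Lim_transform_eventually[OF tendsto_const])
      show "\<forall>\<^sub>F \<tau> in at_right 0. h v = dir_quotient h 0 v \<tau>"
        using eventually_at_right_less
      proof eventually_elim
        case (elim \<tau>)
        then show ?case
          using hom[of \<tau> v] hom[of 0 0] by (simp add: dir_quotient_def)
      qed
    qed
    ultimately show ?thesis
      using tendsto_unique trivial_limit_at_right_real by blast
  qed
  with sub[OF p] sub[OF q] show thesis
    using that by blast
qed


section \<open>Composition of differences of convex functions\<close>

lemma dc_on_diff:
  assumes "dc_on S f" "dc_on S g"
  shows "dc_on S (\<lambda>x. f x - g x)"
proof -
  obtain p q p' q' where c: "convex_on S p" "convex_on S q" "convex_on S p'" "convex_on S q'"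
    and eq: "\<And>x. x \<in> S \<Longrightarrow> f x = p x - q x" "\<And>x. x \<in> S \<Longrightarrow> g x = p' x - q' x"
    using assms unfolding dc_on_def by metis
  have "convex_on S (\<lambda>x. p x + q' x)" "convex_on S (\<lambda>x. q x + p' x)"
    using c by auto
  moreover have "\<forall>x\<in>S. f x - g x = (p x + q' x) - (q x + p' x)"
    by (simp add: eq)
  ultimately show ?thesis
    unfolding dc_on_def by blast
qed

lemma convex_on_sum_fun:
  assumes "finite I" "convex S" "\<And>i. i \<in> I \<Longrightarrow> convex_on S (f i)"
  shows "convex_on S (\<lambda>x. \<Sum>i\<in>I. f i x)"
  using assms by (induction I rule: finite_induct) (auto simp: convex_on_const)

text \<open>
  The function added to \<open>P \<circ> G\<close> has to absorb the non-affinity of \<open>G\<close>. Subadditivity of \<open>P\<close>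
  splits off the vector \<open>d\<close> by which \<open>G\<close> at a convex combination differs from the convex combination
  of its values, and \<open>P d\<close> is bounded by \<open>C\<close> times the sum of the \<open>\<bar>d $ k\<bar>\<close>.
\<close>

lemma dc_on_sublinear_compose:
  fixes G :: "'a::real_vector \<Rightarrow> real ^ 'm"
  assumes P: "sublinear P" and "convex S" and G: "\<And>k. dc_on S (\<lambda>x. G x $ k)"
  shows "dc_on S (\<lambda>x. P (G x))"
proof -
  obtain C where C: "C \<ge> 0" "\<And>w. P w \<le> C * norm w"
    using sublinear_le_norm[OF P] by blast
  obtain a b where a: "\<And>k. convex_on S (a k)" and b: "\<And>k. convex_on S (b k)"
    and eq: "\<And>k x. x \<in> S \<Longrightarrow> G x $ k = a k x - b k x"
    using G unfolding dc_on_def by metis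
  define s where "s x = C * (\<Sum>k\<in>UNIV. a k x + b k x)" for x
  have s: "convex_on S s"
    unfolding s_def using C(1) a b \<open>convex S\<close>
    by (intro convex_on_cmul convex_on_sum_fun convex_on_add) auto
  have "convex_on S (\<lambda>x. P (G x) + s x)"
  proof (rule convex_onI)
    fix t :: real and x y
    assume t: "0 < t" "t < 1" and xy: "x \<in> S" "y \<in> S"
    define z where "z = (1 - t) *\<^sub>R x + t *\<^sub>R y"
    have z: "z \<in> S"
      using \<open>convex S\<close> t xy by (simp add: z_def convex_alt)
    define d where "d = G z - ((1 - t) *\<^sub>R G x + t *\<^sub>R G y)"
    \<comment> \<open>The component \<open>d $ k\<close> is the difference of the convexity gaps of \<open>b k\<close> and \<open>a k\<close>. Both gaps
      are nonnegative, so their sum bounds its absolute value.\<close>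
    have "\<bar>d $ k\<bar> \<le> ((1 - t) * (a k x + b k x) + t * (a k y + b k y)) - (a k z + b k z)" for k
    proof -
      have "a k z \<le> (1 - t) * a k x + t * a k y" "b k z \<le> (1 - t) * b k x + t * b k y"
        using convex_onD[OF a, of t x y k] convex_onD[OF b, of t x y k] t xy
        by (simp_all add: z_def)
      moreover have "d $ k = (a k z - b k z) - ((1 - t) * (a k x - b k x) + t * (a k y - b k y))"
        by (simp add: d_def eq xy z)
      ultimately show ?thesis
        by (simp add: abs_le_iff algebra_simps)
    qed
    then have "(\<Sum>k\<in>UNIV. \<bar>d $ k\<bar>)
        \<le> (\<Sum>k\<in>UNIV. ((1 - t) * (a k x + b k x) + t * (a k y + b k y)) - (a k z + b k z))"
      by (rule sum_mono)
    with norm_le_l1_cart[of d] have "C * norm d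
        \<le> C * (\<Sum>k\<in>UNIV. ((1 - t) * (a k x + b k x) + t * (a k y + b k y)) - (a k z + b k z))"
      using C(1) by (intro mult_left_mono) auto
    also have "\<dots> = (1 - t) * s x + t * s y - s z"
      by (simp only: s_def sum_subtractf sum.distrib sum_distrib_left[symmetric])
        (simp add: algebra_simps)
    finally have "P d \<le> (1 - t) * s x + t * s y - s z"
      using C(2)[of d] by linarith
    moreover have "P (G z) \<le> P ((1 - t) *\<^sub>R G x + t *\<^sub>R G y) + P d"
      using sublinear_add_le[OF P, of "(1 - t) *\<^sub>R G x + t *\<^sub>R G y" d] by (simp add: d_def)
    moreover have "P ((1 - t) *\<^sub>R G x + t *\<^sub>R G y) \<le> (1 - t) * P (G x) + t * P (G y)"
      using P t by (intro convex_onD) (auto simp: sublinear_def)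
    ultimately show "P (G ((1 - t) *\<^sub>R x + t *\<^sub>R y)) + s ((1 - t) *\<^sub>R x + t *\<^sub>R y)
        \<le> (1 - t) * (P (G x) + s x) + t * (P (G y) + s y)"
      unfolding z_def[symmetric] by (simp add: distrib_left)
  qed fact
  with s show ?thesis
    unfolding dc_on_def by (intro exI[of _ "\<lambda>x. P (G x) + s x"] exI[of _ s]) simp
qed


section \<open>Quasi-dc functions\<close>

lemma quasi_dc_on_compose:
  fixes F :: "'a::real_normed_vector \<Rightarrow> real ^ 'm"
  assumes F: "\<And>k. quasi_dc_on S (\<lambda>x. F x $ k)" and g: "quasi_dc_on \<Omega> g"
    and "open S" "open \<Omega>" "F ` S \<subseteq> \<Omega>"
  shows "quasi_dc_on S (g \<circ> F)"
  unfolding quasi_dc_on_def quasi_dc_at_def bouligand_differentiable_on_def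
proof (intro ballI conjI allI)
  fix x assume x: "x \<in> S"
  then show "x \<in> S" .
  have Fx: "F x \<in> \<Omega>"
    using x \<open>F ` S \<subseteq> \<Omega>\<close> by blast
  have lipF: "locally_lipschitz_on S F"
    unfolding locally_lipschitz_on_vec_iff using F x
    by (auto simp: quasi_dc_on_def quasi_dc_at_def bouligand_differentiable_on_def)
  have lipg: "locally_lipschitz_on \<Omega> g"
    using g Fx by (auto simp: quasi_dc_on_def quasi_dc_at_def bouligand_differentiable_on_def)
  show "locally_lipschitz_on S (g \<circ> F)"
    using lipF lipg \<open>F ` S \<subseteq> \<Omega>\<close> \<open>open S\<close> by (rule locally_lipschitz_on_compose)
  define F' where "F' y v = (\<chi> k. dir_deriv (\<lambda>x. F x $ k) y v)" for y v
  have lim: "(dir_quotient (g \<circ> F) y v \<longlongrightarrow> dir_deriv g (F y) (F' y v)) (at_right 0)"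
    if y: "y \<in> S" for y v
  proof (rule dir_quotient_compose_tendsto[OF lipg \<open>open \<Omega>\<close>])
    show Fy: "F y \<in> \<Omega>"
      using y \<open>F ` S \<subseteq> \<Omega>\<close> by blast
    show "(dir_quotient g (F y) (F' y v) \<longlongrightarrow> dir_deriv g (F y) (F' y v)) (at_right 0)"
      using g Fy by (intro dir_differentiable_tendsto)
        (auto simp: quasi_dc_on_def quasi_dc_at_def bouligand_differentiable_on_def)
    show "((\<lambda>\<tau>. (F (y + \<tau> *\<^sub>R v) - F y) /\<^sub>R \<tau>) \<longlongrightarrow> F' y v) (at_right 0)"
    proof (rule vec_tendstoI)
      fix k
      have "dir_differentiable (\<lambda>x. F x $ k) y v"
        using F y by (auto simp: quasi_dc_on_def quasi_dc_at_def bouligand_differentiable_on_def)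
      from dir_differentiable_tendsto[OF this]
      show "((\<lambda>\<tau>. ((F (y + \<tau> *\<^sub>R v) - F y) /\<^sub>R \<tau>) $ k) \<longlongrightarrow> F' y v $ k) (at_right 0)"
        by (simp add: F'_def dir_quotient_def[abs_def] divide_inverse mult.commute)
    qed
  qed
  then show "dir_differentiable (g \<circ> F) y v" if "y \<in> S" for y v
    using that unfolding dir_differentiable_def by blast
  have eq: "dir_deriv (g \<circ> F) x = (\<lambda>v. dir_deriv g (F x) (F' x v))"
    using dir_deriv_eqI[OF lim[OF x]] by blast
  have "dc_on UNIV (dir_deriv g (F x))"
    using g Fx by (auto simp: quasi_dc_on_def quasi_dc_at_def)
  moreover have "dir_deriv g (F x) (c *\<^sub>R w) = c * dir_deriv g (F x) w" if "c \<ge> 0" for c w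
    using g Fx that by (intro dir_deriv_scaleR)
      (auto simp: quasi_dc_on_def quasi_dc_at_def bouligand_differentiable_on_def)
  ultimately obtain P Q where PQ: "sublinear P" "sublinear Q"
    "\<And>w. dir_deriv g (F x) w = P w - Q w"
    using homogeneous_dc_imp_sublinear_diff by metis
  have "dc_on UNIV (\<lambda>v. F' x v $ k)" for k
    using F x by (auto simp: F'_def quasi_dc_on_def quasi_dc_at_def)
  then have "dc_on UNIV (\<lambda>v. P (F' x v))" "dc_on UNIV (\<lambda>v. Q (F' x v))"
    using PQ(1,2) by (simp_all add: dc_on_sublinear_compose)
  then have "dc_on UNIV (\<lambda>v. P (F' x v) - Q (F' x v))"
    by (rule dc_on_diff)
  then show "dc_on UNIV (dir_deriv (g \<circ> F) x)"
    by (simp add: eq PQ(3))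
qed

lemma differentiable_imp_quasi_dc_on:
  assumes lip: "locally_lipschitz_on S f" and diff: "f differentiable_on S" and "open S"
  shows "quasi_dc_on S f"
proof -
  have "\<exists>D. linear D \<and> (\<forall>v. (dir_quotient f x v \<longlongrightarrow> D v) (at_right 0))" if x: "x \<in> S" for x
  proof -
    have "f differentiable (at x)"
      using diff x \<open>open S\<close> by (simp add: differentiable_on_eq_differentiable_at)
    then obtain D where "(f has_derivative D) (at x)"
      unfolding differentiable_def by blast
    then show ?thesis
      using dir_quotient_has_derivative has_derivative_linear by blast
  qed
  then obtain D where lin: "\<And>x. x \<in> S \<Longrightarrow> linear (D x)"
    and lim: "\<And>x v. x \<in> S \<Longrightarrow> (dir_quotient f x v \<longlongrightarrow> D x v) (at_right 0)"
    by metis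
  have "dc_on UNIV (dir_deriv f x)" if x: "x \<in> S" for x
    unfolding dc_on_def
  proof (intro exI conjI ballI)
    show "convex_on UNIV (D x)"
      by (rule convex_onI) (simp_all add: linear_add[OF lin[OF x]] linear_scale[OF lin[OF x]])
    show "convex_on UNIV (\<lambda>_. 0 :: real)"
      by (simp add: convex_on_const)
    show "dir_deriv f x v = D x v - 0" for v
      using dir_deriv_eqI[OF lim[OF x]] by simp
  qed
  then show ?thesis
    using lip lim
    unfolding quasi_dc_on_def quasi_dc_at_def bouligand_differentiable_on_def dir_differentiable_def
    by blast
qed

theorem proposition9:
  fixes \<O> :: "(real ^ 'n) set"
    and f :: "'m::finite \<Rightarrow> real ^ 'n \<Rightarrow> real"
    and F :: "real ^ 'n \<Rightarrow> real ^ 'm"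
    and \<Omega> :: "(real ^ 'm) set"
    and g :: "real ^ 'm \<Rightarrow> real"
  assumes "open \<O>" and "convex \<O>"
    and "F = (\<lambda>x. \<chi> k. f k x)"
    and "open \<Omega>" and "convex \<Omega>" and "F ` \<O> \<subseteq> \<Omega>"
  shows "((\<forall>k. quasi_dc_on \<O> (f k)) \<and> quasi_dc_on \<Omega> g \<longrightarrow> quasi_dc_on \<O> (g \<circ> F)) \<and>
         (F differentiable_on \<O> \<and> locally_lipschitz_on \<O> F \<and> dc_on \<Omega> g
            \<longrightarrow> quasi_dc_on \<O> (g \<circ> F))"
proof (intro conjI impI; elim conjE)
  have comp: "(\<lambda>x. F x $ k) = f k" for k
    by (simp add: assms(3))
  assume "\<forall>k. quasi_dc_on \<O> (f k)" "quasi_dc_on \<Omega> g"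
  then show "quasi_dc_on \<O> (g \<circ> F)"
    using assms(1,4,6) by (intro quasi_dc_on_compose[of \<O> F \<Omega>]) (auto simp: comp)
next
  assume diff: "F differentiable_on \<O>" and lip: "locally_lipschitz_on \<O> F" and g: "dc_on \<Omega> g"
  have "quasi_dc_on \<O> (\<lambda>x. F x $ k)" for k
  proof (rule differentiable_imp_quasi_dc_on)
    show "locally_lipschitz_on \<O> (\<lambda>x. F x $ k)"
      using lip locally_lipschitz_on_vec_iff by blast
    show "(\<lambda>x. F x $ k) differentiable_on \<O>"
      using diff bounded_linear.has_derivative[OF bounded_linear_vec_nth[of k]]
      unfolding differentiable_on_def differentiable_def by fast
  qed fact
  then show "quasi_dc_on \<O> (g \<circ> F)"
    using dc_on_imp_quasi_dc_on[OF g \<open>open \<Omega>\<close>] assms(1,4,6) by (intro quasi_dc_on_compose)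
qed

end
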